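(* Let $A$ be an associative ring with unit, let $M$ be a simple right $A$-module with structure morphism $\eta^A_M:A\to\operatorname{End}_{\mathbb Z}(M)$, and let $A_M\subseteq E_M$ be the local function ring of $A$ in $M$. Then $A_M$ satisfies the following universal property. There exists a homomorphism $\eta:A\to A_M$ such that $\eta(s)$ is a unit (in $A_M$) whenever $s\in\eta^{-1}(D_M\setminus\{0\})$. If $B$ is any other associative ring with a homomorphism $\kappa:A\to B$ such that $\kappa(s)$ is a unit whenever $s\in\eta^{-1}(D_M\setminus\{0\})$, and $\ker\eta\subseteq\ker\kappa$, then there exists a unique homomorphism $\rho:A_M\to B$ such that $\eta\circ\rho=\kappa$ (first $\eta$, then $\rho$).
   Context: All rings are associative with unit and homomorphisms are unital. Maps are composed from left to right: $f\circ g$ means first $f$, then $g$, i.e. $(f\circ g)(m)=g(f(m))$; the multiplication in $\operatorname{End}_{\mathbb Z}(M)$ is this composition. A right $A$-module structure on an abelian group $M$ is given by the ring homomorphism (structure morphism) $\eta^A_M:A\to\operatorname{End}_{\mathbb Z}(M)$, $ma=\eta^A_M(a)(m)$. A right module is simple if it is nonzero and has no proper submodule other than $0$. Put $E_M=\operatorname{End}_{\mathbb Z}(M)$ and $D_M=\operatorname{End}_A(M)$, a division ring regarded as a subring of $E_M$. The local function ring $A_M$ of $A$ in $M$ is the subring of $E_M$ generated over $\operatorname{im}\eta^A_M$ by the subset $\{\eta^A_M(s)^{-1}\mid s\in A,\ \eta^A_M(s)\in D_M\setminus\{0\}\subset E_M\}$. For a homomorphism $\eta:A\to A_M$, $\eta^{-1}(D_M\setminus\{0\})$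 is the set of $s\in A$ with $\eta(s)\in D_M\setminus\{0\}$ inside $E_M$. *)

theory Defs
  imports "HOL-Algebra.Algebra"
begin

text \<open>
  As usual in this library, an abelian group is a ring record satisfying
  \<^locale>\<open>abelian_group\<close>; its multiplicative fields are ignored. Endomorphisms are
  extensional functions, so that equality in the ring below is equality of maps on the carrier.
  The product \<open>f \<otimes> g\<close> is ``first \<open>f\<close>, then \<open>g\<close>''.
\<close>

definition End_ring :: "('m, 's) ring_scheme \<Rightarrow> ('m \<Rightarrow> 'm) ring" where
  "End_ring M =
    \<lparr> carrier = hom (add_monoid M) (add_monoid M) \<inter> extensional (carrier M),
      monoid.mult = (\<lambda>f g. compose (carrier M) g f),
      monoid.one = (\<lambda>m\<in>carrier M. m),
      ring.zero = (\<lambda>m\<in>carrier M. \<zero>\<^bsub>M\<^esub>),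
      ring.add = (\<lambda>f g. \<lambda>m\<in>carrier M. f m \<oplus>\<^bsub>M\<^esub> g m) \<rparr>"

text \<open>
  A right module is given by its structure morphism \<open>\<eta>\<close>; the action is \<open>m a = \<eta> a m\<close>.
  (The library's \<^locale>\<open>module\<close> requires a commutative ring of scalars.)
\<close>

locale right_module = A: ring A + M: abelian_group M
  for A :: "('a, 'r) ring_scheme" and M :: "('m, 's) ring_scheme"
    and \<eta> :: "'a \<Rightarrow> 'm \<Rightarrow> 'm" +
  assumes structure_morphism: "\<eta> \<in> ring_hom A (End_ring M)"

definition right_submodule ::
  "('a, 'r) ring_scheme \<Rightarrow> ('m, 's) ring_scheme \<Rightarrow> ('a \<Rightarrow> 'm \<Rightarrow> 'm) \<Rightarrow> 'm set \<Rightarrow> bool" where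
  "right_submodule A M \<eta> N \<longleftrightarrow>
    additive_subgroup N M \<and> (\<forall>a\<in>carrier A. \<forall>n\<in>N. \<eta> a n \<in> N)"

locale simple_right_module = right_module +
  assumes nonzero: "carrier M \<noteq> {\<zero>\<^bsub>M\<^esub>}"
    and no_proper_submodule:
      "right_submodule A M \<eta> N \<Longrightarrow> N = {\<zero>\<^bsub>M\<^esub>} \<or> N = carrier M"

definition module_End ::
  "('a, 'r) ring_scheme \<Rightarrow> ('m, 's) ring_scheme \<Rightarrow> ('a \<Rightarrow> 'm \<Rightarrow> 'm) \<Rightarrow> ('m \<Rightarrow> 'm) set" where
  "module_End A M \<eta> =
    {f \<in> carrier (End_ring M). \<forall>a\<in>carrier A. \<forall>m\<in>carrier M. f (\<eta> a m) = \<eta> a (f m)}"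

definition local_function_ring ::
  "('a, 'r) ring_scheme \<Rightarrow> ('m, 's) ring_scheme \<Rightarrow> ('a \<Rightarrow> 'm \<Rightarrow> 'm) \<Rightarrow> ('m \<Rightarrow> 'm) ring" where
  "local_function_ring A M \<eta> =
    (End_ring M)\<lparr> carrier := generate_ring (End_ring M)
      (\<eta> ` carrier A \<union>
       {inv\<^bsub>End_ring M\<^esub> (\<eta> s) | s.
          s \<in> carrier A \<and> \<eta> s \<in> module_End A M \<eta> - {\<zero>\<^bsub>End_ring M\<^esub>}}) \<rparr>"

lemma (in abelian_group) ring_End_ring: "ring (End_ring G)"
proof -
  let ?E = "End_ring G"
  have homD: "f x \<in> carrier G" "f (x \<oplus> y) = f x \<oplus> f y"
    if "f \<in> carrier ?E" "x \<in> carrier G" "y \<in> carrier G" for f x y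
    using that by (auto simp: End_ring_def hom_def)
  have homI: "f \<in> carrier ?E"
    if "f \<in> extensional (carrier G)" "\<And>x. x \<in> carrier G \<Longrightarrow> f x \<in> carrier G"
      "\<And>x y. x \<in> carrier G \<Longrightarrow> y \<in> carrier G \<Longrightarrow> f (x \<oplus> y) = f x \<oplus> f y" for f
    using that by (auto simp: End_ring_def hom_def)
  have eqI: "f = g" if "f \<in> carrier ?E" "g \<in> carrier ?E"
      "\<And>x. x \<in> carrier G \<Longrightarrow> f x = g x" for f g
    using that by (auto simp: End_ring_def intro: extensionalityI)
  have app [simp]: "(f \<oplus>\<^bsub>?E\<^esub> g) x = f x \<oplus> g x" "(f \<otimes>\<^bsub>?E\<^esub> g) x = g (f x)"
      "\<one>\<^bsub>?E\<^esub> x = x" "\<zero>\<^bsub>?E\<^esub> x = \<zero>" if "x \<in> carrier G" for f g x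
    using that by (auto simp: End_ring_def compose_def)
  have add_c: "f \<oplus>\<^bsub>?E\<^esub> g \<in> carrier ?E" if "f \<in> carrier ?E" "g \<in> carrier ?E" for f g
    using that by (intro homI) (simp_all add: homD a_ac, simp add: End_ring_def)
  have mult_c: "f \<otimes>\<^bsub>?E\<^esub> g \<in> carrier ?E" if "f \<in> carrier ?E" "g \<in> carrier ?E" for f g
    using that by (intro homI) (simp_all add: homD, simp add: End_ring_def)
  have zero_c: "\<zero>\<^bsub>?E\<^esub> \<in> carrier ?E" by (intro homI) (simp_all, simp add: End_ring_def)
  have one_c: "\<one>\<^bsub>?E\<^esub> \<in> carrier ?E" by (intro homI) (simp_all, simp add: End_ring_def)
  have neg: "\<exists>g\<in>carrier ?E. g \<oplus>\<^bsub>?E\<^esub> f = \<zero>\<^bsub>?E\<^esub>" if f: "f \<in> carrier ?E" for f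
  proof
    show g: "(\<lambda>x\<in>carrier G. \<ominus> f x) \<in> carrier ?E"
      using f by (intro homI) (simp_all add: homD minus_add)
    show "(\<lambda>x\<in>carrier G. \<ominus> f x) \<oplus>\<^bsub>?E\<^esub> f = \<zero>\<^bsub>?E\<^esub>"
      using f by (intro eqI add_c g zero_c) (simp_all add: homD l_neg)
  qed
  show ?thesis
  proof (intro ringI abelian_groupI monoidI)
  qed (auto intro!: eqI add_c mult_c zero_c one_c neg simp: homD add_c mult_c zero_c one_c a_ac)
qed

end

theory Submission
  imports Defs
begin

text \<open>
  By Schur's lemma, a nonzero endomorphism \<open>\<eta> s \<in> D\<^sub>M\<close> is invertible in \<open>E\<^sub>M\<close>, and being
  \<open>A\<close>-linear it commutes with the image of \<open>\<eta>\<close>. Hence the elements to be inverted form a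
  multiplicatively closed set of central units over \<open>im \<eta>\<close>, and \<open>A\<^sub>M\<close> consists of the fractions
  \<open>\<eta> a (\<eta> s)\<^sup>-\<^sup>1\<close>. The inclusion \<open>ker \<eta> \<subseteq> ker \<kappa>\<close> carries every relation between
  numerators and denominators, commutation included, over to \<open>B\<close>, so that
  \<open>\<eta> a (\<eta> s)\<^sup>-\<^sup>1 \<mapsto> \<kappa> a (\<kappa> s)\<^sup>-\<^sup>1\<close> is well defined and a homomorphism.
\<close>

section \<open>Fractions with central denominators\<close>

text \<open>The relation x = h(a) h(s)^(-1) in product form. It makes sense for any map
  \<open>h\<close>, so the same pair \<open>a\<close>, \<open>s\<close> can be compared in different
  target rings, and homomorphisms carry it over without mention of inverses.\<close>

definition is_fraction ::
  "('b, 'n) ring_scheme \<Rightarrow> ('a \<Rightarrow> 'b) \<Rightarrow> 'b \<Rightarrow> 'a \<Rightarrow> 'a \<Rightarrow> bool" where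
  "is_fraction S h x a s \<longleftrightarrow> x \<in> carrier S \<and> x \<otimes>\<^bsub>S\<^esub> h s = h a"

text \<open>Denominators need to commute only with the image of \<open>h\<close>, not with all of
  \<open>S\<close>. Such a condition is an equation between values of \<open>h\<close>, which a
  kernel inclusion can carry to another ring.\<close>

locale central_denominators = ring_hom_ring R S h
  for R (structure) and S (structure) and h +
  fixes D
  assumes D_subset: "D \<subseteq> carrier R"
    and one_in_D: "\<one> \<in> D"
    and D_mult: "\<lbrakk> s \<in> D; t \<in> D \<rbrakk> \<Longrightarrow> s \<otimes> t \<in> D"
    and D_Units: "s \<in> D \<Longrightarrow> h s \<in> Units S"
    and D_central: "\<lbrakk> s \<in> D; a \<in> carrier R \<rbrakk> \<Longrightarrow> h s \<otimes>\<^bsub>S\<^esub> h a = h a \<otimes>\<^bsub>S\<^esub> h s"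
begin

section \<open>Existence, uniqueness and arithmetic of fractions\<close>

lemma D_closed [simp]: "s \<in> D \<Longrightarrow> s \<in> carrier R"
  using D_subset by blast

lemma right_cancel_D:
  assumes "s \<in> D" "x \<in> carrier S" "y \<in> carrier S" "x \<otimes>\<^bsub>S\<^esub> h s = y \<otimes>\<^bsub>S\<^esub> h s"
  shows "x = y"
proof -
  have "x = x \<otimes>\<^bsub>S\<^esub> h s \<otimes>\<^bsub>S\<^esub> inv\<^bsub>S\<^esub> h s"
    using assms(1,2) D_Units by (simp add: S.m_assoc)
  also have "\<dots> = y"
    using assms D_Units by (simp add: S.m_assoc)
  finally show ?thesis .
qed

lemma is_fraction_unique:
  "\<lbrakk> s \<in> D; is_fraction S h x a s; is_fraction S h y a s \<rbrakk> \<Longrightarrow> x = y"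
  using right_cancel_D by (simp add: is_fraction_def)

lemma is_fraction_exists:
  assumes "a \<in> carrier R" "s \<in> D"
  shows "\<exists>x. is_fraction S h x a s"
proof
  show "is_fraction S h (h a \<otimes>\<^bsub>S\<^esub> inv\<^bsub>S\<^esub> h s) a s"
    using assms D_Units by (simp add: is_fraction_def S.m_assoc)
qed

lemma is_fraction_hom: "a \<in> carrier R \<Longrightarrow> is_fraction S h (h a) a \<one>"
  by (simp add: is_fraction_def)

lemma is_fraction_inv: "s \<in> D \<Longrightarrow> is_fraction S h (inv\<^bsub>S\<^esub> h s) \<one> s"
  using D_Units by (simp add: is_fraction_def)

lemma is_fraction_minus:
  assumes "a \<in> carrier R" "s \<in> D" "is_fraction S h x a s"
  shows "is_fraction S h (\<ominus>\<^bsub>S\<^esub> x) (\<ominus> a) s"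
  using assms by (simp add: is_fraction_def S.l_minus)

text \<open>Multiplying by \<open>h s\<close> and then \<open>h t\<close> clears both denominators;
  for \<open>y\<close> the two factors are swapped first, so that \<open>h t\<close> meets
  \<open>y\<close>.\<close>

lemma is_fraction_add:
  assumes "a \<in> carrier R" "s \<in> D" "is_fraction S h x a s"
    and "b \<in> carrier R" "t \<in> D" "is_fraction S h y b t"
  shows "is_fraction S h (x \<oplus>\<^bsub>S\<^esub> y) (a \<otimes> t \<oplus> b \<otimes> s) (s \<otimes> t)"
proof -
  have [simp]: "x \<in> carrier S" "y \<in> carrier S"
    using assms by (simp_all add: is_fraction_def)
  have "x \<otimes>\<^bsub>S\<^esub> (h s \<otimes>\<^bsub>S\<^esub> h t) = h a \<otimes>\<^bsub>S\<^esub> h t"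
    using assms by (simp add: is_fraction_def flip: S.m_assoc)
  moreover have "y \<otimes>\<^bsub>S\<^esub> (h s \<otimes>\<^bsub>S\<^esub> h t) = y \<otimes>\<^bsub>S\<^esub> h t \<otimes>\<^bsub>S\<^esub> h s"
    using assms(2,5) D_central[of s t] by (simp add: S.m_assoc)
  ultimately show ?thesis
    using assms by (simp add: is_fraction_def S.l_distr)
qed

text \<open>The factor \<open>h s\<close> has to move past \<open>y\<close> to reach
  \<open>x\<close>. It does so after \<open>h t\<close> has turned \<open>y\<close> into
  \<open>h b\<close>, so commutation with the image of \<open>h\<close> suffices.\<close>

lemma is_fraction_mult:
  assumes "a \<in> carrier R" "s \<in> D" "is_fraction S h x a s"
    and "b \<in> carrier R" "t \<in> D" "is_fraction S h y b t"
  shows "is_fraction S h (x \<otimes>\<^bsub>S\<^esub> y) (a \<otimes> b) (s \<otimes> t)"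
proof -
  have [simp]: "x \<in> carrier S" "y \<in> carrier S"
    and x: "x \<otimes>\<^bsub>S\<^esub> h s = h a" and y: "y \<otimes>\<^bsub>S\<^esub> h t = h b"
    using assms by (simp_all add: is_fraction_def)
  have "x \<otimes>\<^bsub>S\<^esub> y \<otimes>\<^bsub>S\<^esub> (h s \<otimes>\<^bsub>S\<^esub> h t) = x \<otimes>\<^bsub>S\<^esub> (y \<otimes>\<^bsub>S\<^esub> h t \<otimes>\<^bsub>S\<^esub> h s)"
    using assms(2,5) D_central[of s t] by (simp add: S.m_assoc)
  also have "\<dots> = x \<otimes>\<^bsub>S\<^esub> (h s \<otimes>\<^bsub>S\<^esub> h b)"
    using assms(2,4) D_central[of s b] by (simp add: y)
  also have "\<dots> = h a \<otimes>\<^bsub>S\<^esub> h b"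
    using assms(2,4) by (simp add: x flip: S.m_assoc)
  finally show ?thesis
    using assms by (simp add: is_fraction_def)
qed

section \<open>The ring generated by numerators and inverse denominators\<close>

text \<open>The abstract form of \<open>local_function_ring\<close>.\<close>

definition fraction_ring where
  "fraction_ring = S\<lparr>carrier := generate_ring S (h ` carrier R \<union> {inv\<^bsub>S\<^esub> (h s) | s. s \<in> D})\<rparr>"

lemma fraction_ring_simps [simp]:
  "x \<otimes>\<^bsub>fraction_ring\<^esub> y = x \<otimes>\<^bsub>S\<^esub> y" "\<one>\<^bsub>fraction_ring\<^esub> = \<one>\<^bsub>S\<^esub>"
  "x \<oplus>\<^bsub>fraction_ring\<^esub> y = x \<oplus>\<^bsub>S\<^esub> y" "\<zero>\<^bsub>fraction_ring\<^esub> = \<zero>\<^bsub>S\<^esub>"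
  by (simp_all add: fraction_ring_def)

lemma hom_in_fraction_ring [simp]: "a \<in> carrier R \<Longrightarrow> h a \<in> carrier fraction_ring"
  by (auto simp: fraction_ring_def intro: generate_ring.incl)

lemma inv_in_fraction_ring: "s \<in> D \<Longrightarrow> inv\<^bsub>S\<^esub> (h s) \<in> carrier fraction_ring"
  by (auto simp: fraction_ring_def intro: generate_ring.incl)

lemma ring_fraction_ring: "ring fraction_ring"
  unfolding fraction_ring_def using D_Units by (intro S.generate_ring_is_ring) auto

lemma hom_fraction_ring: "h \<in> ring_hom R fraction_ring"
  by (intro ring_hom_memI) simp_all

lemma D_Units_fraction_ring: "s \<in> D \<Longrightarrow> h s \<in> Units fraction_ring"
  using inv_in_fraction_ring[of s] D_Units[of s]
  by (auto simp: Units_def[of fraction_ring] intro!: bexI[of _ "inv\<^bsub>S\<^esub> (h s)"])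

text \<open>The generators are the fractions a/1 and 1/s, and fractions are closed under negation,
  sum and product, so induction over the generated ring applies.\<close>

lemma fraction_ring_fraction:
  assumes "x \<in> carrier fraction_ring"
  obtains a s where "a \<in> carrier R" "s \<in> D" "is_fraction S h x a s"
proof -
  have "x \<in> generate_ring S (h ` carrier R \<union> {inv\<^bsub>S\<^esub> (h s) | s. s \<in> D})"
    using assms by (simp add: fraction_ring_def)
  then have "\<exists>a\<in>carrier R. \<exists>s\<in>D. is_fraction S h x a s"
  proof (induction rule: generate_ring.induct)
    case one
    then show ?case using is_fraction_hom[of \<one>] one_in_D by auto
  next
    case (incl x)
    then show ?case using is_fraction_hom is_fraction_inv one_in_D R.one_closed by blast
  next
    case (a_inv x)
    then show ?case using is_fraction_minus R.a_inv_closed by blast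
  next
    case (eng_add x y)
    then obtain a s b t where "a \<in> carrier R" "s \<in> D" "is_fraction S h x a s"
      "b \<in> carrier R" "t \<in> D" "is_fraction S h y b t"
      by blast
    then show ?case
      using is_fraction_add[of a s x b t y] D_mult[of s t]
      by (intro bexI[of _ "a \<otimes> t \<oplus> b \<otimes> s"] bexI[of _ "s \<otimes> t"]) simp_all
  next
    case (eng_mult x y)
    then show ?case using is_fraction_mult D_mult R.m_closed by meson
  qed
  with that show ?thesis by blast
qed

text \<open>Serves uniqueness: the value at \<open>x\<close> of a homomorphism extending
  \<open>k\<close> solves the fraction equation over \<open>T\<close>, which has only one solution
  once \<open>k s\<close> is a unit.\<close>

lemma fraction_ring_hom_is_fraction:
  assumes \<rho>: "\<rho> \<in> ring_hom fraction_ring T"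
    and ext: "\<And>a. a \<in> carrier R \<Longrightarrow> \<rho> (h a) = k a"
    and x: "x \<in> carrier fraction_ring" "a \<in> carrier R" "s \<in> D" "is_fraction S h x a s"
  shows "is_fraction T k (\<rho> x) a s"
  using ring_hom_mult[OF \<rho> x(1), of "h s"] ring_hom_closed[OF \<rho> x(1)] x(2-)
  by (simp add: is_fraction_def ext)

end

section \<open>Kernel inclusion and the universal property\<close>

text \<open>Apply the inclusion to the difference of \<open>a\<close> and \<open>b\<close>. In this
  form it transports every equation between values of \<open>h\<close>.\<close>

lemma (in ring_hom_ring) kernel_subset_eq:
  assumes "ring_hom_ring R T k" "a_kernel R S h \<subseteq> a_kernel R T k"
    and "a \<in> carrier R" "b \<in> carrier R" "h a = h b"
  shows "k a = k b"
proof -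
  interpret k: ring_hom_ring R T k by fact
  have "a \<ominus> b \<in> a_kernel R S h"
    using assms(3-) by (simp add: a_kernel_def' R.minus_eq S.r_neg del: kernel_zero k.kernel_zero)
  then have "k a \<ominus>\<^bsub>T\<^esub> k b = \<zero>\<^bsub>T\<^esub>"
    using assms(2-4) by (auto simp: a_kernel_def' R.minus_eq k.S.minus_eq simp del: kernel_zero k.kernel_zero)
  with assms(3,4) show ?thesis by simp
qed

context central_denominators
begin

text \<open>Commutation of \<open>h s\<close> and \<open>h a\<close> says that \<open>h\<close>
  agrees on the two products of \<open>s\<close> and \<open>a\<close>, and this passes to
  \<open>k\<close>. The remaining conditions are assumed or concern \<open>D\<close> alone.\<close>

lemma central_denominators_transfer:
  assumes "ring_hom_ring R T k" "a_kernel R S h \<subseteq> a_kernel R T k"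
    and "\<And>s. s \<in> D \<Longrightarrow> k s \<in> Units T"
  shows "central_denominators R T k D"
proof -
  interpret k: ring_hom_ring R T k by fact
  show ?thesis
  proof
    show "k s \<otimes>\<^bsub>T\<^esub> k a = k a \<otimes>\<^bsub>T\<^esub> k s" if "s \<in> D" "a \<in> carrier R" for s a
      using that D_central[of s a] kernel_subset_eq[OF assms(1,2), of "s \<otimes> a" "a \<otimes> s"] by simp
  qed (use assms(3) D_subset one_in_D D_mult in auto)
qed

text \<open>Extensionality fixes the values outside the carrier, so that uniqueness is equality of
  functions.\<close>

theorem fraction_ring_universal:
  assumes "ring T" and k: "k \<in> ring_hom R T" and Units: "\<And>s. s \<in> D \<Longrightarrow> k s \<in> Units T"
    and ker: "a_kernel R S h \<subseteq> a_kernel R T k"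
  shows "\<exists>!\<rho>. \<rho> \<in> ring_hom fraction_ring T \<and> \<rho> \<in> extensional (carrier fraction_ring)
    \<and> (\<forall>a\<in>carrier R. \<rho> (h a) = k a)"
proof -
  have hom_k: "ring_hom_ring R T k"
    using R.ring_axioms \<open>ring T\<close> k by (rule ring_hom_ringI2)
  interpret k: central_denominators R T k D
    using hom_k ker Units by (rule central_denominators_transfer)
  interpret F: ring fraction_ring by (rule ring_fraction_ring)
  \<comment> \<open>Independence of the representation: cross-multiplying two representations of
    \<open>x\<close> gives h(a t) = h(b s), hence k(a t) = k(b s), and cancelling \<open>k s\<close>
    yields the equation for \<open>b\<close> and \<open>t\<close>.\<close>
  have change: "is_fraction T k y b t"
    if a: "a \<in> carrier R" "s \<in> D" "is_fraction S h x a s" and b: "b \<in> carrier R" "t \<in> D" "is_fraction S h x b t"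
      and y: "is_fraction T k y a s" for x y a s b t
  proof -
    have [simp]: "x \<in> carrier S" "y \<in> carrier T" using a y by (simp_all add: is_fraction_def)
    have "h (a \<otimes> t) = x \<otimes>\<^bsub>S\<^esub> h s \<otimes>\<^bsub>S\<^esub> h t" using a b by (simp add: is_fraction_def)
    also have "\<dots> = x \<otimes>\<^bsub>S\<^esub> h t \<otimes>\<^bsub>S\<^esub> h s"
      using a b D_central[of s t] by (simp add: S.m_assoc)
    also have "\<dots> = h (b \<otimes> s)" using a b by (simp add: is_fraction_def)
    finally have eq: "k (a \<otimes> t) = k (b \<otimes> s)"
      using a b by (intro kernel_subset_eq[OF hom_k ker]) simp_all
    have "y \<otimes>\<^bsub>T\<^esub> k t \<otimes>\<^bsub>T\<^esub> k s = y \<otimes>\<^bsub>T\<^esub> k s \<otimes>\<^bsub>T\<^esub> k t"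
      using a b k.D_central[of s t] by (simp add: k.S.m_assoc)
    also have "\<dots> = k b \<otimes>\<^bsub>T\<^esub> k s" using a b y eq by (simp add: is_fraction_def)
    finally have "y \<otimes>\<^bsub>T\<^esub> k t = k b"
      using a b k.right_cancel_D[of s "y \<otimes>\<^bsub>T\<^esub> k t" "k b"] by simp
    then show ?thesis by (simp add: is_fraction_def)
  qed
  \<comment> \<open>One value \<open>y\<close> serves all representations of \<open>x\<close>, so
    the choice function \<open>f\<close> obtained below depends on \<open>x\<close> alone.\<close>
  have "\<exists>y. \<forall>a\<in>carrier R. \<forall>s\<in>D. is_fraction S h x a s \<longrightarrow> is_fraction T k y a s"
    if "x \<in> carrier fraction_ring" for x
  proof -
    obtain a s where as: "a \<in> carrier R" "s \<in> D" "is_fraction S h x a s"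
      using \<open>x \<in> carrier fraction_ring\<close> by (rule fraction_ring_fraction)
    obtain y where "is_fraction T k y a s" using k.is_fraction_exists as by blast
    then show ?thesis using change as by blast
  qed
  then obtain f where f: "is_fraction T k (f x) a s"
    if "x \<in> carrier fraction_ring" "a \<in> carrier R" "s \<in> D" "is_fraction S h x a s" for x a s
    by metis
  define \<rho> where "\<rho> = restrict f (carrier fraction_ring)"
  have \<rho>: "is_fraction T k (\<rho> x) a s"
    if "x \<in> carrier fraction_ring" "a \<in> carrier R" "s \<in> D" "is_fraction S h x a s" for x a s
    using f that by (simp add: \<rho>_def)
  \<comment> \<open>Both \<open>h a\<close> and \<open>k a\<close> are the fraction a/1 in their
    rings.\<close>
  have \<rho>_h: "\<rho> (h a) = k a" if "a \<in> carrier R" for a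
    using that k.is_fraction_unique[OF one_in_D \<rho> k.is_fraction_hom] is_fraction_hom one_in_D
    by simp
  have \<rho>_hom: "\<rho> \<in> ring_hom fraction_ring T"
  proof (rule ring_hom_memI)
    show "\<rho> x \<in> carrier T" if x: "x \<in> carrier fraction_ring" for x
      using fraction_ring_fraction[OF x] \<rho>[OF x] by (metis is_fraction_def)
    show "\<rho> \<one>\<^bsub>fraction_ring\<^esub> = \<one>\<^bsub>T\<^esub>"
      using \<rho>_h[of \<one>] by simp
  next
    fix x y assume x: "x \<in> carrier fraction_ring" and y: "y \<in> carrier fraction_ring"
    obtain a s where a: "a \<in> carrier R" "s \<in> D" "is_fraction S h x a s"
      using x by (rule fraction_ring_fraction)
    obtain b t where b: "b \<in> carrier R" "t \<in> D" "is_fraction S h y b t"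
      using y by (rule fraction_ring_fraction)
    note st = D_mult[OF a(2) b(2)]
    have *: "is_fraction T k (\<rho> x) a s" "is_fraction T k (\<rho> y) b t"
      using \<rho> x y a b by simp_all
    \<comment> \<open>Here and for sums, both sides are fractions in \<open>T\<close> with the same
      numerator and denominator: the left by the property of \<open>\<rho>\<close>, the right by
      fraction arithmetic over \<open>k\<close>.\<close>
    show "\<rho> (x \<otimes>\<^bsub>fraction_ring\<^esub> y) = \<rho> x \<otimes>\<^bsub>T\<^esub> \<rho> y"
      using F.m_closed[OF x y] a b * st
      by (intro k.is_fraction_unique[OF st \<rho> k.is_fraction_mult[OF a(1,2) *(1) b(1,2) *(2)]])
        (simp_all add: is_fraction_mult)
    show "\<rho> (x \<oplus>\<^bsub>fraction_ring\<^esub> y) = \<rho> x \<oplus>\<^bsub>T\<^esub> \<rho> y"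
      using F.a_closed[OF x y] a b * st
      by (intro k.is_fraction_unique[OF st \<rho> k.is_fraction_add[OF a(1,2) *(1) b(1,2) *(2)]])
        (simp_all add: is_fraction_add)
  qed
  show ?thesis
  proof (rule ex1I)
    show "\<rho> \<in> ring_hom fraction_ring T \<and> \<rho> \<in> extensional (carrier fraction_ring)
        \<and> (\<forall>a\<in>carrier R. \<rho> (h a) = k a)"
      using \<rho>_hom \<rho>_h by (simp add: \<rho>_def)
  next
    fix \<sigma> assume \<sigma>: "\<sigma> \<in> ring_hom fraction_ring T \<and> \<sigma> \<in> extensional (carrier fraction_ring)
        \<and> (\<forall>a\<in>carrier R. \<sigma> (h a) = k a)"
    show "\<sigma> = \<rho>"
    proof (rule extensionalityI)
      fix x assume x: "x \<in> carrier fraction_ring"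
      then obtain a s where "a \<in> carrier R" "s \<in> D" "is_fraction S h x a s"
        by (rule fraction_ring_fraction)
      then show "\<sigma> x = \<rho> x"
        using \<rho>[OF x] fraction_ring_hom_is_fraction[of \<sigma> T k x a s] \<sigma> x
        by (intro k.is_fraction_unique[of s _ a]) simp_all
    qed (use \<sigma> in \<open>auto simp: \<rho>_def\<close>)
  qed
qed

end

section \<open>Schur's lemma and the local function ring\<close>

lemma End_ring_app [simp]:
  assumes "x \<in> carrier M"
  shows "(f \<otimes>\<^bsub>End_ring M\<^esub> g) x = g (f x)" "\<one>\<^bsub>End_ring M\<^esub> x = x" "\<zero>\<^bsub>End_ring M\<^esub> x = \<zero>\<^bsub>M\<^esub>"
  using assms by (simp_all add: End_ring_def compose_def)

lemma End_ring_eqI: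
  assumes "f \<in> carrier (End_ring M)" "g \<in> carrier (End_ring M)"
    and "\<And>x. x \<in> carrier M \<Longrightarrow> f x = g x"
  shows "f = g"
  using assms by (auto simp: End_ring_def intro: extensionalityI)

lemma (in abelian_group) End_ring_abelian_group_hom:
  "f \<in> carrier (End_ring G) \<Longrightarrow> abelian_group_hom G G f"
  by (intro abelian_group_homI abelian_group_axioms)
    (auto simp: End_ring_def intro: group_hom.intro group_hom_axioms.intro a_group)

lemma (in abelian_group) bij_betw_End_ring_Units:
  assumes f: "f \<in> carrier (End_ring G)" and bij: "bij_betw f (carrier G) (carrier G)"
  shows "f \<in> Units (End_ring G)"
proof -
  interpret E: ring "End_ring G" by (rule ring_End_ring)
  interpret f: abelian_group_hom G G f using f by (rule End_ring_abelian_group_hom)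
  \<comment> \<open>The restriction makes the inverse map extensional, as membership in
    \<open>End_ring\<close> demands.\<close>
  define g where "g = restrict (inv_into (carrier G) f) (carrier G)"
  have gf [simp]: "g (f x) = x" "f (g x) = x" "g x \<in> carrier G" if "x \<in> carrier G" for x
    using that bij by (simp_all add: g_def bij_betw_inv_into_left bij_betw_inv_into_right
      inv_into_into bij_betw_imp_surj_on)
  have g_ext: "g \<in> extensional (carrier G)" by (simp add: g_def)
  \<comment> \<open>By additivity \<open>f\<close> sends \<open>g x \<oplus> g y\<close> to
    \<open>x \<oplus> y\<close>; now apply \<open>g\<close>.\<close>
  have "g (x \<oplus> y) = g x \<oplus> g y" if "x \<in> carrier G" "y \<in> carrier G" for x y
    using gf(1)[of "g x \<oplus> g y"] that by simp
  then have g: "g \<in> carrier (End_ring G)"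
    using g_ext by (simp add: End_ring_def hom_def)
  have "g \<otimes>\<^bsub>End_ring G\<^esub> f = \<one>\<^bsub>End_ring G\<^esub>" "f \<otimes>\<^bsub>End_ring G\<^esub> g = \<one>\<^bsub>End_ring G\<^esub>"
    using f g by (auto intro!: End_ring_eqI)
  with f g show ?thesis by (auto simp: Units_def)
qed

section \<open>Simple modules\<close>

context simple_right_module
begin

text \<open>Kernel and image of \<open>f\<close> are submodules. A point with nonzero value keeps
  the kernel from being all of \<open>M\<close> and the image from being zero, so \<open>f\<close>
  is bijective.\<close>

lemma module_End_nonzero_Units:
  assumes f: "f \<in> module_End A M \<eta>" and nz: "f \<noteq> \<zero>\<^bsub>End_ring M\<^esub>"
  shows "f \<in> Units (End_ring M)"
proof -
  interpret E: ring "End_ring M" by (rule M.ring_End_ring)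
  have fE: "f \<in> carrier (End_ring M)"
    and lin: "\<And>a m. a \<in> carrier A \<Longrightarrow> m \<in> carrier M \<Longrightarrow> f (\<eta> a m) = \<eta> a (f m)"
    using f by (auto simp: module_End_def)
  interpret f: abelian_group_hom M M f using fE by (rule M.End_ring_abelian_group_hom)
  have act: "\<eta> a m \<in> carrier M" "\<eta> a \<zero>\<^bsub>M\<^esub> = \<zero>\<^bsub>M\<^esub>" if "a \<in> carrier A" "m \<in> carrier M" for a m
  proof -
    interpret \<eta>a: abelian_group_hom M M "\<eta> a"
      using ring_hom_closed[OF structure_morphism \<open>a \<in> carrier A\<close>]
      by (rule M.End_ring_abelian_group_hom)
    show "\<eta> a m \<in> carrier M" "\<eta> a \<zero>\<^bsub>M\<^esub> = \<zero>\<^bsub>M\<^esub>" using that by simp_all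
  qed
  \<comment> \<open>Two distinct extensional maps differ at a point of the carrier.\<close>
  obtain m where m: "m \<in> carrier M" "f m \<noteq> \<zero>\<^bsub>M\<^esub>"
    using nz End_ring_eqI[OF fE E.zero_closed] by auto
  have "right_submodule A M \<eta> (a_kernel M M f)"
    using f.additive_subgroup_a_kernel act lin
    by (auto simp: right_submodule_def a_kernel_def' simp del: f.kernel_zero)
  then have "a_kernel M M f = {\<zero>\<^bsub>M\<^esub>}"
    using no_proper_submodule m by (force simp: a_kernel_def' simp del: f.kernel_zero)
  then have "inj_on f (carrier M)"
    using group_hom.inj_iff_trivial_ker[OF f.a_group_hom] by (simp add: a_kernel_def)
  moreover have "right_submodule A M \<eta> (f ` carrier M)"
  proof -
    have "additive_subgroup (f ` carrier M) M"
      using group_hom.img_is_subgroup[OF f.a_group_hom] by (simp add: additive_subgroup_def)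
    then show ?thesis
      using act by (auto simp: right_submodule_def simp flip: lin)
  qed
  then have "f ` carrier M = carrier M"
    using no_proper_submodule m by blast
  ultimately show ?thesis
    using fE by (intro M.bij_betw_End_ring_Units) (simp_all add: bij_betw_def)
qed

text \<open>Puts the unit of \<open>A\<close> among the denominators and keeps units of the
  endomorphism ring from being zero.\<close>

lemma End_ring_one_not_zero: "\<one>\<^bsub>End_ring M\<^esub> \<noteq> \<zero>\<^bsub>End_ring M\<^esub>"
proof
  assume "\<one>\<^bsub>End_ring M\<^esub> = \<zero>\<^bsub>End_ring M\<^esub>"
  then have "m = \<zero>\<^bsub>M\<^esub>" if "m \<in> carrier M" for m
    using that by (metis End_ring_app(2,3))
  with nonzero show False by auto
qed

text \<open>Invertibility is Schur's lemma, and \<open>A\<close>-linearity read pointwise is exactly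
  commutation with the image of \<open>\<eta>\<close>.\<close>

lemma central_denominators_module_End:
  "central_denominators A (End_ring M) \<eta>
    {s \<in> carrier A. \<eta> s \<in> module_End A M \<eta> - {\<zero>\<^bsub>End_ring M\<^esub>}}"
proof -
  interpret E: ring "End_ring M" by (rule M.ring_End_ring)
  interpret \<eta>: ring_hom_ring A "End_ring M" \<eta>
    using A.ring_axioms E.ring_axioms structure_morphism by (rule ring_hom_ringI2)
  have maps: "f m \<in> carrier M" if "f \<in> carrier (End_ring M)" "m \<in> carrier M" for f m
    using that by (auto simp: End_ring_def hom_def)
  show ?thesis
  proof
    show "\<one>\<^bsub>A\<^esub> \<in> {s \<in> carrier A. \<eta> s \<in> module_End A M \<eta> - {\<zero>\<^bsub>End_ring M\<^esub>}}"
      using End_ring_one_not_zero by (auto simp: module_End_def maps)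
  next
    fix s t
    assume s: "s \<in> {s \<in> carrier A. \<eta> s \<in> module_End A M \<eta> - {\<zero>\<^bsub>End_ring M\<^esub>}}"
      and t: "t \<in> {s \<in> carrier A. \<eta> s \<in> module_End A M \<eta> - {\<zero>\<^bsub>End_ring M\<^esub>}}"
    \<comment> \<open>The product is nonzero because it is a unit: a unit equal to zero would force
      one to equal zero.\<close>
    have "\<eta> s \<otimes>\<^bsub>End_ring M\<^esub> \<eta> t \<in> Units (End_ring M)"
      using s t module_End_nonzero_Units by auto
    then have "\<eta> s \<otimes>\<^bsub>End_ring M\<^esub> \<eta> t \<noteq> \<zero>\<^bsub>End_ring M\<^esub>"
      using End_ring_one_not_zero E.Units_r_inv E.Units_inv_closed E.l_null by metis
    moreover have "\<eta> s \<otimes>\<^bsub>End_ring M\<^esub> \<eta> t \<in> module_End A M \<eta>"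
    proof -
      have lin: "\<eta> r (\<eta> a m) = \<eta> a (\<eta> r m)"
        if "\<eta> r \<in> module_End A M \<eta>" "a \<in> carrier A" "m \<in> carrier M" for r a m
        using that by (simp add: module_End_def)
      have "\<eta> t (\<eta> s (\<eta> a m)) = \<eta> a (\<eta> t (\<eta> s m))" if "a \<in> carrier A" "m \<in> carrier M" for a m
        using s t that lin[of s a m] lin[of t a "\<eta> s m"] maps[of "\<eta> s" m] by simp
      moreover have "\<eta> s \<in> carrier (End_ring M)" "\<eta> t \<in> carrier (End_ring M)"
        using s t by simp_all
      ultimately show ?thesis by (simp add: module_End_def maps)
    qed
    ultimately show "s \<otimes>\<^bsub>A\<^esub> t \<in> {s \<in> carrier A. \<eta> s \<in> module_End A M \<eta> - {\<zero>\<^bsub>End_ring M\<^esub>}}"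
      using s t by simp
  next
    fix s a
    assume "s \<in> {s \<in> carrier A. \<eta> s \<in> module_End A M \<eta> - {\<zero>\<^bsub>End_ring M\<^esub>}}" "a \<in> carrier A"
    then show "\<eta> s \<otimes>\<^bsub>End_ring M\<^esub> \<eta> a = \<eta> a \<otimes>\<^bsub>End_ring M\<^esub> \<eta> s"
      by (intro End_ring_eqI E.m_closed) (auto simp: module_End_def)
  qed (use module_End_nonzero_Units in auto)
qed

end

text \<open>The clause on \<open>eta_M\<close> pins the witness to the structure morphism on the
  carrier, so the property concerns the canonical map.\<close>

theorem lemma4:
  fixes A :: "('a, 'r) ring_scheme" and M :: "('m, 's) ring_scheme"
    and eta_M :: "'a \<Rightarrow> 'm \<Rightarrow> 'm"
  assumes "simple_right_module A M eta_M"
  defines "A_M \<equiv> local_function_ring A M eta_M"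
    and "D_M \<equiv> module_End A M eta_M"
    and "E_M \<equiv> End_ring M"
  shows "\<exists>\<eta>. \<eta> \<in> ring_hom A A_M
    \<and> (\<forall>a\<in>carrier A. \<eta> a = eta_M a)
    \<and> (\<forall>s\<in>carrier A. \<eta> s \<in> D_M - {\<zero>\<^bsub>E_M\<^esub>} \<longrightarrow> \<eta> s \<in> Units A_M)
    \<and> (\<forall>(B :: ('c, 'd) ring_scheme) \<kappa>.
          ring B \<longrightarrow> \<kappa> \<in> ring_hom A B
          \<longrightarrow> (\<forall>s\<in>carrier A. \<eta> s \<in> D_M - {\<zero>\<^bsub>E_M\<^esub>} \<longrightarrow> \<kappa> s \<in> Units B)
          \<longrightarrow> a_kernel A A_M \<eta> \<subseteq> a_kernel A B \<kappa>
          \<longrightarrow> (\<exists>!\<rho>. \<rho> \<in> ring_hom A_M B \<and> \<rho> \<in> extensional (carrier A_M)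
                \<and> (\<forall>a\<in>carrier A. \<rho> (\<eta> a) = \<kappa> a)))"
proof -
  interpret simple_right_module A M eta_M by fact
  define S where "S = {s \<in> carrier A. eta_M s \<in> D_M - {\<zero>\<^bsub>E_M\<^esub>}}"
  interpret L: central_denominators A E_M eta_M S
    unfolding S_def D_M_def E_M_def by (rule central_denominators_module_End)
  have A_M: "A_M = L.fraction_ring"
    unfolding A_M_def local_function_ring_def L.fraction_ring_def by (simp add: S_def D_M_def E_M_def del: L.D_closed)
  \<comment> \<open>\<open>A_M\<close> and \<open>E_M\<close> share their zero, so the kernel
    hypothesis can be read in \<open>E_M\<close>, as the abstract theorem requires.\<close>
  have ker: "a_kernel A A_M eta_M = a_kernel A E_M eta_M"
    by (simp add: A_M a_kernel_def' del: L.kernel_zero)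
  show ?thesis
  proof (intro exI[of _ eta_M] conjI ballI allI impI)
    show "eta_M \<in> ring_hom A A_M"
      unfolding A_M by (rule L.hom_fraction_ring)
    show "eta_M s \<in> Units A_M" if "s \<in> carrier A" "eta_M s \<in> D_M - {\<zero>\<^bsub>E_M\<^esub>}" for s
      unfolding A_M using that by (intro L.D_Units_fraction_ring) (simp add: S_def del: L.D_closed)
  next
    fix B :: "('c, 'd) ring_scheme" and \<kappa>
    assume "ring B" "\<kappa> \<in> ring_hom A B"
      and "\<forall>s\<in>carrier A. eta_M s \<in> D_M - {\<zero>\<^bsub>E_M\<^esub>} \<longrightarrow> \<kappa> s \<in> Units B"
      and "a_kernel A A_M eta_M \<subseteq> a_kernel A B \<kappa>"
    then show "\<exists>!\<rho>. \<rho> \<in> ring_hom A_M B \<and> \<rho> \<in> extensional (carrier A_M)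
        \<and> (\<forall>a\<in>carrier A. \<rho> (eta_M a) = \<kappa> a)"
      unfolding ker unfolding A_M by (intro L.fraction_ring_universal) (auto simp: S_def simp del: L.D_closed)
  qed simp
qed

end
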